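(* Let $G^\sigma$ be a connected oriented unicyclic graph of order $n$ whose unique cycle $C_k^\sigma$ has length $k$, and assume $sr(G^\sigma)=k$ if $k$ is even and $sr(G^\sigma)=k+1$ if $k$ is odd. (1) If there exists a vertex $v\in V(C_k^\sigma)$ which is saturated in $G^\sigma\{v\}$, then $G^\sigma\{v\}$ is an oriented star and $\beta(G^\sigma-G^\sigma\{v\})=\frac{k-2}{2}$ if $k$ is even, $=\frac{k-1}{2}$ if $k$ is odd (with no condition on the orientation). (2) If no vertex $v\in V(C_k^\sigma)$ is saturated in $G^\sigma\{v\}$, then: (a) if $k$ is odd, $G\cong U^*$ (with no condition on the orientation); (b) if $k$ is even, $G\cong U^*$ and $C_k^\sigma$ is evenly-oriented.
   Context: An oriented graph $G^\sigma$ is a simple graph $G$ (underlying graph) together with an orientation of each edge. Its skew-adjacency matrix $S(G^\sigma)=(s_{ij})$ has $s_{ij}=1$ if there is an arc from $v_i$ to $v_j$, $s_{ij}=-1$ if there is an arc from $v_j$ to $v_i$, and $0$ otherwise; the skew-rank $sr(G^\sigma)$ is its rank. For an even cycle $u_1\cdots u_ku_1$, its sign is the sign of $\prod_{i=1}^k s_{u_iu_{i+1}}$ ($u_{k+1}=u_1$); it is evenly-oriented if this sign is positive. For a vertex $v$ on the cycle, $G^\sigma\{v\}$ is the component containing $v$ of the graph obtained by deleting the cycle edges (a tree rooted at $v$). A vertex $v$ of a tree $T$ is saturated in $T$ if every maximum matching of $T$ covers $v$. $\beta(H)$ is the matching number. $U^*$ is the graph obtained from a cycle $C_k$ and a star $S_{n-k}$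 (on $n-k$ vertices) by adding an edge between a vertex of $C_k$ and the center of $S_{n-k}$.
   Formalization: The formal theorem adds the assumption k < n (G is not itself a cycle); without it an even cycle that is not evenly-oriented has skew-rank k and no saturated cycle vertex, yet it violates (2)(b), and U* is undefined for n = k. *)

theory Defs
  imports "HOL-Analysis.Analysis"
begin

text \<open>An oriented graph on the (finite) vertex type 'v is given by its ar relation
  ar x y meaning "there is an arc from x to y".  It must be loopless and have no
  pair of opposite arcs (the orientation of a simple graph).\<close>

definition oriented_graph :: "('v \<Rightarrow> 'v \<Rightarrow> bool) \<Rightarrow> bool" where
  "oriented_graph ar \<longleftrightarrow> (\<forall>x. \<not> ar x x) \<and> (\<forall>x y. ar x y \<longrightarrow> \<not> ar y x)"

definition und :: "('v \<Rightarrow> 'v \<Rightarrow> bool) \<Rightarrow> 'v \<Rightarrow> 'v \<Rightarrow> bool" where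
  "und ar x y \<longleftrightarrow> ar x y \<or> ar y x"

definition skew_entry :: "('v \<Rightarrow> 'v \<Rightarrow> bool) \<Rightarrow> 'v \<Rightarrow> 'v \<Rightarrow> real" where
  "skew_entry ar x y = (if ar x y then 1 else if ar y x then -1 else 0)"

definition skew_adj :: "('v::finite \<Rightarrow> 'v \<Rightarrow> bool) \<Rightarrow> real^'v^'v" where
  "skew_adj ar = (\<chi> i j. skew_entry ar i j)"

definition skew_rank :: "('v::finite \<Rightarrow> 'v \<Rightarrow> bool) \<Rightarrow> nat" where
  "skew_rank ar = rank (skew_adj ar)"

definition connected_graph :: "('v \<Rightarrow> 'v \<Rightarrow> bool) \<Rightarrow> bool" where
  "connected_graph E \<longleftrightarrow> (\<forall>x y. E\<^sup>*\<^sup>* x y)"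

definition is_cycle :: "('v \<Rightarrow> 'v \<Rightarrow> bool) \<Rightarrow> 'v list \<Rightarrow> bool" where
  "is_cycle E cs \<longleftrightarrow> length cs \<ge> 3 \<and> distinct cs \<and>
     (\<forall>i < length cs. E (cs ! i) (cs ! ((i + 1) mod length cs)))"

definition cycle_edges :: "'v list \<Rightarrow> 'v set set" where
  "cycle_edges cs = {{cs ! i, cs ! ((i + 1) mod length cs)} | i. i < length cs}"

definition unicyclic :: "('v \<Rightarrow> 'v \<Rightarrow> bool) \<Rightarrow> bool" where
  "unicyclic E \<longleftrightarrow> connected_graph E \<and> (\<exists>cs. is_cycle E cs) \<and>
     (\<forall>cs cs'. is_cycle E cs \<longrightarrow> is_cycle E cs' \<longrightarrow> cycle_edges cs = cycle_edges cs')"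

definition cycle_sign_prod :: "('v \<Rightarrow> 'v \<Rightarrow> bool) \<Rightarrow> 'v list \<Rightarrow> real" where
  "cycle_sign_prod ar cs =
     (\<Prod>i < length cs. skew_entry ar (cs ! i) (cs ! ((i + 1) mod length cs)))"

definition evenly_oriented :: "('v \<Rightarrow> 'v \<Rightarrow> bool) \<Rightarrow> 'v list \<Rightarrow> bool" where
  "evenly_oriented ar cs \<longleftrightarrow> even (length cs) \<and> cycle_sign_prod ar cs > 0"

text \<open>Graph obtained by deleting the cycle edges, and the tree G{v}
  (vertex set and edge relation).\<close>
definition del_cycle :: "('v \<Rightarrow> 'v \<Rightarrow> bool) \<Rightarrow> 'v list \<Rightarrow> 'v \<Rightarrow> 'v \<Rightarrow> bool" where
  "del_cycle E cs x y \<longleftrightarrow> E x y \<and> {x, y} \<notin> cycle_edges cs"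

definition branch_verts :: "('v \<Rightarrow> 'v \<Rightarrow> bool) \<Rightarrow> 'v list \<Rightarrow> 'v \<Rightarrow> 'v set" where
  "branch_verts E cs v = {w. (del_cycle E cs)\<^sup>*\<^sup>* v w}"

definition graph_edges :: "'v set \<Rightarrow> ('v \<Rightarrow> 'v \<Rightarrow> bool) \<Rightarrow> 'v set set" where
  "graph_edges W E = {{x, y} | x y. x \<in> W \<and> y \<in> W \<and> E x y}"

definition is_matching :: "'v set \<Rightarrow> ('v \<Rightarrow> 'v \<Rightarrow> bool) \<Rightarrow> 'v set set \<Rightarrow> bool" where
  "is_matching W E M \<longleftrightarrow> M \<subseteq> graph_edges W E \<and>
     (\<forall>e \<in> M. \<forall>e' \<in> M. e \<noteq> e' \<longrightarrow> e \<inter> e' = {})"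

definition matching_number :: "'v set \<Rightarrow> ('v \<Rightarrow> 'v \<Rightarrow> bool) \<Rightarrow> nat" where
  "matching_number W E = Max (card ` {M. is_matching W E M})"

definition is_max_matching :: "'v set \<Rightarrow> ('v \<Rightarrow> 'v \<Rightarrow> bool) \<Rightarrow> 'v set set \<Rightarrow> bool" where
  "is_max_matching W E M \<longleftrightarrow> is_matching W E M \<and> card M = matching_number W E"

definition saturated :: "'v set \<Rightarrow> ('v \<Rightarrow> 'v \<Rightarrow> bool) \<Rightarrow> 'v \<Rightarrow> bool" where
  "saturated W E v \<longleftrightarrow> (\<forall>M. is_max_matching W E M \<longrightarrow> v \<in> \<Union>M)"

definition is_star :: "'v set \<Rightarrow> ('v \<Rightarrow> 'v \<Rightarrow> bool) \<Rightarrow> bool" where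
  "is_star W E \<longleftrightarrow> (\<exists>c \<in> W. (\<forall>x \<in> W. x \<noteq> c \<longrightarrow> E c x) \<and>
     (\<forall>x \<in> W. \<forall>y \<in> W. E x y \<longrightarrow> x = c \<or> y = c))"

text \<open>The graph U* on vertices {0..<n}: cycle 0,1,...,k-1, the star S_{n-k} on
  {k..<n} with centre k, and the edge joining cycle vertex 0 to the centre k.\<close>
definition ustar_adj :: "nat \<Rightarrow> nat \<Rightarrow> nat \<Rightarrow> nat \<Rightarrow> bool" where
  "ustar_adj k n x y \<longleftrightarrow> x < n \<and> y < n \<and>
     ((x < k \<and> y < k \<and> (y = (x + 1) mod k \<or> x = (y + 1) mod k)) \<or>
      ({x, y} = {0, k}) \<or>
      (x = k \<and> k < y) \<or> (y = k \<and> k < x))"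

definition iso_ustar :: "('v \<Rightarrow> 'v \<Rightarrow> bool) \<Rightarrow> nat \<Rightarrow> nat \<Rightarrow> bool" where
  "iso_ustar E k n \<longleftrightarrow> (\<exists>f. bij_betw f UNIV {0..<n} \<and>
     (\<forall>x y. E x y \<longleftrightarrow> ustar_adj k n (f x) (f y)))"

end

theory Submission
  imports Defs
begin

text \<open>
  Only lower bounds for the skew-rank are needed. Call a vertex set \<open>W\<close> nonsingular if the principal
  submatrix of the skew-adjacency matrix on \<open>W\<close> is; then the skew-rank is at least \<open>card W\<close>. Adding
  two adjacent vertices, one of which is pendant in the enlarged set, keeps \<open>W\<close> nonsingular. In a
  unicyclic graph, peeling off pendant vertices therefore shows that the vertices covered by a
  matching \<open>M\<close> form a nonsingular set as soon as some cycle vertex is not matched by a cycle edge; so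
  the skew-rank is at least \<open>2 * card M\<close>.

  The hypothesis on the rank says that it equals \<open>2 * ((k - 1) div 2) + 2\<close>, and the cycle without one
  vertex has a matching with \<open>(k - 1) div 2\<close> edges. If \<open>v\<close> is saturated in its branch, joining maximum
  matchings of the branch and of the rest shows that the branch has matching number 1 (so it is a
  star) and that the rest has matching number \<open>(k - 1) div 2\<close>. If no cycle vertex is saturated, maximum
  matchings of all branches that avoid the cycle, joined with a matching of the cycle without one vertex,
  show that the branches contribute exactly one edge, which leaves only \<open>U*\<close>. Finally, an even cycle
  that is not evenly-oriented is itself nonsingular, and together with that edge it would give rank
  at least \<open>k + 2\<close>.
\<close>

subsection \<open>Nonsingular principal submatrices\<close>

definition nonsingular_on :: "real^'n^'n \<Rightarrow> 'n set \<Rightarrow> bool" where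
  "nonsingular_on A W \<longleftrightarrow>
     (\<forall>x. (\<forall>i\<in>W. (\<Sum>j\<in>W. A $ i $ j * x j) = 0) \<longrightarrow> (\<forall>i\<in>W. x i = 0))"

lemma nonsingular_on_empty: "nonsingular_on A {}"
  by (simp add: nonsingular_on_def)

lemma card_le_rank_if_nonsingular_on:
  fixes A :: "real^'n^'n"
  assumes "nonsingular_on A W"
  shows "card W \<le> rank A"
proof -
  define V where "V = {x::real^'n. \<forall>i. i \<notin> W \<longrightarrow> x $ i = 0}"
  have subspace: "subspace V"
    by (auto simp: V_def subspace_def)
  have trivial_kernel: "x = 0" if "x \<in> V" "A *v x = 0" for x
  proof -
    have "(\<Sum>j\<in>W. A $ i $ j * x $ j) = 0" for i
    proof -
      have "(\<Sum>j\<in>W. A $ i $ j * x $ j) = (A *v x) $ i"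
        unfolding matrix_vector_mult_def vec_lambda_beta
        by (rule sum.mono_neutral_left) (use that(1) in \<open>auto simp: V_def\<close>)
      then show ?thesis using that(2) by simp
    qed
    then have "\<forall>i\<in>W. x $ i = 0"
      using assms unfolding nonsingular_on_def by blast
    then show ?thesis
      using that(1) by (auto simp: V_def vec_eq_iff)
  qed
  have "inj_on ((*v) A) V"
    using trivial_kernel linear_injective_on_subspace_0[OF matrix_vector_mul_linear subspace] by blast
  then have "inj_on ((*v) A) (span V)"
    by (metis span_eq_iff subspace)
  then have "dim V = dim ((*v) A ` V)"
    by (simp add: dim_image_eq)
  moreover have "card W = dim V"
    using dim_substandard_cart[of W, where 'a = real] by (simp add: V_def dim_vec_eq)
  moreover have "dim ((*v) A ` V) \<le> rank A"
    unfolding rank_dim_range by (rule dim_subset) blast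
  ultimately show ?thesis by simp
qed

lemma nonsingular_on_insert_pendant:
  fixes A :: "real^'n^'n"
  assumes W: "nonsingular_on A W"
    and new: "l \<notin> W" "p \<notin> W" "l \<noteq> p"
    and adjacent: "A $ l $ p \<noteq> 0" "A $ p $ l \<noteq> 0"
    and pendant: "A $ l $ l = 0" "\<And>w. w \<in> W \<Longrightarrow> A $ l $ w = 0" "\<And>w. w \<in> W \<Longrightarrow> A $ w $ l = 0"
  shows "nonsingular_on A (insert l (insert p W))"
  unfolding nonsingular_on_def
proof (intro allI impI)
  fix x
  assume kernel: "\<forall>i\<in>insert l (insert p W). (\<Sum>j\<in>insert l (insert p W). A $ i $ j * x j) = 0"
  have row: "A $ i $ l * x l + A $ i $ p * x p + (\<Sum>j\<in>W. A $ i $ j * x j) = 0"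
    if "i \<in> insert l (insert p W)" for i
    using kernel[rule_format, OF that] new by simp
  have xp: "x p = 0"
    using row[of l] adjacent(1) pendant(1,2) by simp
  have "(\<Sum>j\<in>W. A $ w $ j * x j) = 0" if "w \<in> W" for w
    using row[of w] pendant(3)[OF that] xp that by simp
  then have xW: "\<forall>w\<in>W. x w = 0"
    using W unfolding nonsingular_on_def by blast
  then have "x l = 0"
    using row[of p] adjacent(2) xp by simp
  then show "\<forall>i\<in>insert l (insert p W). x i = 0"
    using xp xW by simp
qed

subsection \<open>Paths and cycles\<close>

locale simple_graph =
  fixes E :: "'v \<Rightarrow> 'v \<Rightarrow> bool"
  assumes sym: "E x y \<Longrightarrow> E y x" and irrefl: "\<not> E x x"

definition is_path :: "('v \<Rightarrow> 'v \<Rightarrow> bool) \<Rightarrow> 'v list \<Rightarrow> bool" where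
  "is_path E ps \<longleftrightarrow> ps \<noteq> [] \<and> distinct ps \<and> successively E ps"

lemma is_path_mono: "is_path D ps \<Longrightarrow> D \<le> E \<Longrightarrow> is_path E ps"
  unfolding is_path_def by (blast intro: successively_mono)

lemma rtranclp_imp_is_path:
  assumes "E\<^sup>*\<^sup>* x y"
  shows "\<exists>ps. is_path E ps \<and> hd ps = x \<and> last ps = y"
  using assms
proof (induction rule: converse_rtranclp_induct)
  case base
  have "is_path E [y] \<and> hd [y] = y \<and> last [y] = y"
    by (simp add: is_path_def)
  then show ?case by blast
next
  case (step x z)
  then obtain ps where ps: "is_path E ps" "hd ps = z" "last ps = y" by blast
  show ?case
  proof (cases "x \<in> set ps")
    case True
    then obtain as bs where "ps = as @ x # bs" by (meson split_list)
    then have "is_path E (x # bs) \<and> hd (x # bs) = x \<and> last (x # bs) = y"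
      using ps by (auto simp: is_path_def successively_append_iff)
    then show ?thesis by blast
  next
    case False
    then have "is_path E (x # ps) \<and> hd (x # ps) = x \<and> last (x # ps) = y"
      using ps step.hyps(1) by (auto simp: is_path_def successively_Cons)
    then show ?thesis by blast
  qed
qed

definition cyclic_nth :: "'a list \<Rightarrow> nat \<Rightarrow> 'a" where
  "cyclic_nth cs i = cs ! (i mod length cs)"

lemma range_cyclic_nth:
  assumes "cs \<noteq> []"
  shows "range (cyclic_nth cs) = set cs"
proof (intro equalityI subsetI)
  fix x assume "x \<in> set cs"
  then obtain i where "i < length cs" "x = cs ! i" by (metis in_set_conv_nth)
  then have "x = cyclic_nth cs i" by (simp add: cyclic_nth_def)
  then show "x \<in> range (cyclic_nth cs)" by blast
qed (use assms in \<open>auto simp: cyclic_nth_def\<close>)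

lemma cyclic_nth_eq_iff:
  assumes "distinct cs" "cs \<noteq> []"
  shows "cyclic_nth cs i = cyclic_nth cs j \<longleftrightarrow> i mod length cs = j mod length cs"
  unfolding cyclic_nth_def by (rule nth_eq_iff_index_eq) (use assms in auto)

lemma cyclic_nth_Suc_eq_iff:
  assumes "distinct cs" "cs \<noteq> []"
  shows "cyclic_nth cs (Suc i) = cyclic_nth cs (Suc j) \<longleftrightarrow> cyclic_nth cs i = cyclic_nth cs j"
  unfolding cyclic_nth_eq_iff[OF assms] using assms(2) by (auto simp: mod_Suc)

lemma is_cycleD:
  assumes "is_cycle E cs"
  shows "3 \<le> length cs" "distinct cs" "cs \<noteq> []"
  using assms by (auto simp: is_cycle_def)

lemma is_cycle_cyclic_nth:
  assumes "is_cycle E cs"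
  shows "E (cyclic_nth cs i) (cyclic_nth cs (Suc i))"
proof -
  have "i mod length cs < length cs"
    using is_cycleD(3)[OF assms] by simp
  then have "E (cs ! (i mod length cs)) (cs ! ((i mod length cs + 1) mod length cs))"
    using assms unfolding is_cycle_def by blast
  then show ?thesis
    by (simp add: cyclic_nth_def mod_simps)
qed

lemma cycle_edges_cyclic_nth:
  assumes "cs \<noteq> []"
  shows "cycle_edges cs = range (\<lambda>i. {cyclic_nth cs i, cyclic_nth cs (Suc i)})"
proof (intro equalityI subsetI)
  fix e assume "e \<in> cycle_edges cs"
  then obtain i where "i < length cs" "e = {cs ! i, cs ! ((i + 1) mod length cs)}"
    unfolding cycle_edges_def by blast
  then have "e = {cyclic_nth cs i, cyclic_nth cs (Suc i)}" by (simp add: cyclic_nth_def)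
  then show "e \<in> range (\<lambda>i. {cyclic_nth cs i, cyclic_nth cs (Suc i)})" by blast
next
  fix e assume "e \<in> range (\<lambda>i. {cyclic_nth cs i, cyclic_nth cs (Suc i)})"
  then obtain i where "e = {cyclic_nth cs i, cyclic_nth cs (Suc i)}" by blast
  then have "e = {cs ! (i mod length cs), cs ! ((i mod length cs + 1) mod length cs)}"
    by (simp add: cyclic_nth_def mod_simps)
  moreover have "i mod length cs < length cs" using assms by simp
  ultimately show "e \<in> cycle_edges cs" unfolding cycle_edges_def by blast
qed

lemma Union_cycle_edges:
  assumes "cs \<noteq> []"
  shows "\<Union>(cycle_edges cs) = set cs"
  unfolding cycle_edges_cyclic_nth[OF assms] range_cyclic_nth[OF assms, symmetric] by blast

lemma cycle_edge_imp_edge: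
  assumes "is_cycle E cs" "e \<in> cycle_edges cs"
  obtains x y where "e = {x, y}" "E x y"
  using assms(2) that is_cycle_cyclic_nth[OF assms(1)]
  unfolding cycle_edges_cyclic_nth[OF is_cycleD(3)[OF assms(1)]] by auto

lemma first_edge_in_cycle_edges: "ds \<noteq> [] \<Longrightarrow> {x, hd ds} \<in> cycle_edges (x # ds)"
  unfolding cycle_edges_def by (intro CollectI exI[of _ 0]) (simp add: hd_conv_nth)

lemma closing_edge_in_cycle_edges: "ds \<noteq> [] \<Longrightarrow> {last ds, x} \<in> cycle_edges (x # ds)"
  unfolding cycle_edges_def
  by (intro CollectI exI[of _ "length ds"]) (simp add: last_conv_nth nth_Cons')

lemma is_cycle_iff_closed_path:
  "is_cycle E cs \<longleftrightarrow> is_path E cs \<and> 3 \<le> length cs \<and> E (last cs) (hd cs)"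
proof (cases "3 \<le> length cs")
  case True
  then have nonempty: "cs \<noteq> []" by auto
  have "(\<forall>i<length cs. E (cs ! i) (cs ! ((i + 1) mod length cs))) \<longleftrightarrow>
      successively E cs \<and> E (last cs) (hd cs)"
  proof (intro iffI conjI)
    assume edges: "\<forall>i<length cs. E (cs ! i) (cs ! ((i + 1) mod length cs))"
    show "successively E cs"
      unfolding successively_conv_nth
    proof (intro allI impI)
      fix i assume "Suc i < length cs"
      then show "E (cs ! i) (cs ! Suc i)"
        using edges[rule_format, of i] by simp
    qed
    show "E (last cs) (hd cs)"
      using edges[rule_format, of "length cs - 1"] nonempty by (simp add: last_conv_nth hd_conv_nth)
  next
    assume closed: "successively E cs \<and> E (last cs) (hd cs)"
    show "\<forall>i<length cs. E (cs ! i) (cs ! ((i + 1) mod length cs))"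
    proof (intro allI impI)
      fix i assume "i < length cs"
      then consider "Suc i < length cs" | "i = length cs - 1" by linarith
      then show "E (cs ! i) (cs ! ((i + 1) mod length cs))"
        using closed nonempty by cases (simp_all add: successively_nth last_conv_nth hd_conv_nth)
    qed
  qed
  then show ?thesis
    using True nonempty by (auto simp: is_cycle_def is_path_def)
qed (simp add: is_cycle_def)

lemma is_cycle_mono: "is_cycle D cs \<Longrightarrow> D \<le> E \<Longrightarrow> is_cycle E cs"
  unfolding is_cycle_def by (meson predicate2D)

lemma is_cycle_append_commute: "is_cycle E (as @ bs) \<Longrightarrow> is_cycle E (bs @ as)"
  by (auto simp: is_cycle_iff_closed_path is_path_def successively_append_iff last_append hd_append
      split: if_splits)

text \<open>Extend the path at its head by a neighbour other than the second vertex: either this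
  neighbour is new, or it closes a cycle.\<close>

lemma (in simple_graph) path_extends_to_cycle:
  assumes "finite W" and degree: "\<And>w q. w \<in> W \<Longrightarrow> \<exists>u\<in>W. E w u \<and> u \<noteq> q"
    and "is_path E ps" "set ps \<subseteq> W"
  shows "\<exists>zs qs rs. zs @ ps = qs @ rs \<and> is_path E (zs @ ps) \<and> set (zs @ ps) \<subseteq> W \<and> is_cycle E qs"
  using assms(3,4)
proof (induction "card (W - set ps)" arbitrary: ps rule: less_induct)
  case less
  obtain x ps' where ps: "ps = x # ps'"
    using less.prems(1) by (cases ps) (auto simp: is_path_def)
  obtain u where u: "u \<in> W" "E x u" "u \<noteq> hd ps'"
    using degree[of x "hd ps'"] less.prems(2) ps by auto
  show ?case
  proof (cases "u \<in> set ps")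
    case False
    have "is_path E (u # ps)"
      using less.prems(1) False sym[OF u(2)] ps by (auto simp: is_path_def)
    moreover have "card (W - set (u # ps)) < card (W - set ps)"
      using False u(1) \<open>finite W\<close> by (intro psubset_card_mono) auto
    moreover have "set (u # ps) \<subseteq> W"
      using less.prems(2) u(1) by simp
    ultimately obtain zs qs rs where "zs @ u # ps = qs @ rs" "is_path E (zs @ u # ps)"
      "set (zs @ u # ps) \<subseteq> W" "is_cycle E qs"
      using less.hyps by blast
    then have "(zs @ [u]) @ ps = qs @ rs \<and> is_path E ((zs @ [u]) @ ps) \<and>
        set ((zs @ [u]) @ ps) \<subseteq> W \<and> is_cycle E qs" by simp
    then show ?thesis by blast
  next
    case True
    then have "u \<in> set ps'" using u(2) irrefl ps by auto
    then obtain as bs where as: "ps' = as @ u # bs" by (meson split_list)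
    then have "as \<noteq> []" using u(3) by auto
    then have "is_cycle E (x # as @ [u])"
      unfolding is_cycle_iff_closed_path
      using less.prems(1) ps as sym[OF u(2)]
      by (auto simp: is_path_def successively_append_iff successively_Cons Suc_le_eq)
    then show ?thesis
      using less.prems ps as by (intro exI[of _ "[]"] exI[of _ "x # as @ [u]"] exI[of _ bs]) simp
  qed
qed

lemma (in simple_graph) exists_pendant_vertex:
  assumes "finite W" "W \<noteq> {}" and no_isolated: "\<And>w. w \<in> W \<Longrightarrow> \<exists>u\<in>W. E w u"
    and cycles: "\<And>ds. is_cycle E ds \<Longrightarrow> set ds = C"
    and v: "v \<in> C" "v \<notin> W \<or> (\<exists>w\<in>W - C. E v w)"
  shows "\<exists>l\<in>W. \<exists>!p. p \<in> W \<and> E l p"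
proof (rule ccontr)
  assume no_pendant: "\<not> ?thesis"
  have degree: "\<exists>u\<in>W. E w u \<and> u \<noteq> q" if "w \<in> W" for w q
    using no_isolated[OF that] no_pendant that by metis
  show False
  proof (cases "v \<in> W")
    case False
    obtain w where "w \<in> W" using \<open>W \<noteq> {}\<close> by blast
    then have "is_path E [w]" "set [w] \<subseteq> W" by (simp_all add: is_path_def)
    then obtain zs qs rs where "zs @ [w] = qs @ rs" "set (zs @ [w]) \<subseteq> W" "is_cycle E qs"
      using path_extends_to_cycle[OF \<open>finite W\<close> degree] by blast
    then have "C \<subseteq> W" using cycles by (metis le_sup_iff set_append)
    then show False using v(1) False by blast
  next
    case True
    then obtain w where w: "w \<in> W" "w \<notin> C" "E v w" using v by blast
    have "is_path E [w, v]" "set [w, v] \<subseteq> W"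
      using w True sym irrefl by (auto simp: is_path_def)
    then obtain zs qs rs where cycle: "zs @ [w, v] = qs @ rs" "is_path E (zs @ [w, v])" "is_cycle E qs"
      using path_extends_to_cycle[OF \<open>finite W\<close> degree] by blast
    have "set qs = C" using cycles cycle(3) .
    have "rs = []"
    proof (rule ccontr)
      assume "rs \<noteq> []"
      then have "last rs = v" using arg_cong[OF cycle(1), of last] by simp
      then have "v \<in> set rs" using \<open>rs \<noteq> []\<close> by (metis last_in_set)
      moreover have "distinct (qs @ rs)" using cycle(1,2) by (simp add: is_path_def)
      ultimately show False using \<open>set qs = C\<close> v(1) by auto
    qed
    then have "qs = zs @ [w, v]" using cycle(1) by simp
    then have "w \<in> set qs" by simp
    then show False using w(2) \<open>set qs = C\<close> by blast
  qed
qed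

subsection \<open>Matchings\<close>

lemma is_matchingE:
  assumes "is_matching W E M" "e \<in> M"
  obtains x y where "e = {x, y}" "x \<in> W" "y \<in> W" "E x y"
  using assms unfolding is_matching_def graph_edges_def by blast

lemma is_matching_disjoint: "is_matching W E M \<Longrightarrow> e \<in> M \<Longrightarrow> f \<in> M \<Longrightarrow> e \<noteq> f \<Longrightarrow> e \<inter> f = {}"
  unfolding is_matching_def by blast

lemma is_matching_empty: "is_matching W E {}"
  by (simp add: is_matching_def)

lemma is_matching_edge: "x \<in> W \<Longrightarrow> y \<in> W \<Longrightarrow> E x y \<Longrightarrow> is_matching W E {{x, y}}"
  unfolding is_matching_def graph_edges_def by blast

lemma is_matching_subset: "is_matching W E M \<Longrightarrow> N \<subseteq> M \<Longrightarrow> is_matching W E N"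
  unfolding is_matching_def by (meson subset_iff)

lemma is_matching_mono:
  assumes "is_matching W D M" "W \<subseteq> W'" "D \<le> E"
  shows "is_matching W' E M"
proof -
  have "graph_edges W D \<subseteq> graph_edges W' E"
    using assms(2,3) unfolding graph_edges_def by blast
  then show ?thesis using assms(1) unfolding is_matching_def by (meson order_trans)
qed

lemma Union_matching_subset: "is_matching W E M \<Longrightarrow> \<Union>M \<subseteq> W"
  by (auto elim: is_matchingE)

lemma is_matching_restrict:
  assumes "is_matching W E M" "\<Union>M \<subseteq> W'"
  shows "is_matching W' E M"
proof -
  have "e \<in> graph_edges W' E" if e: "e \<in> M" for e
  proof -
    obtain x y where "e = {x, y}" "E x y" using is_matchingE[OF assms(1) e] by metis
    moreover from this have "x \<in> W'" "y \<in> W'" using assms(2) e by auto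
    ultimately show ?thesis unfolding graph_edges_def by blast
  qed
  then show ?thesis using assms(1) by (simp add: is_matching_def subset_iff)
qed

lemma is_matching_UN:
  assumes "\<And>i. i \<in> I \<Longrightarrow> is_matching (W i) E (f i)"
    and "\<And>i j. i \<in> I \<Longrightarrow> j \<in> I \<Longrightarrow> i \<noteq> j \<Longrightarrow> W i \<inter> W j = {}"
  shows "is_matching (\<Union>i\<in>I. W i) E (\<Union>i\<in>I. f i)"
  unfolding is_matching_def
proof (intro conjI ballI impI)
  have "is_matching (\<Union>i\<in>I. W i) E (f i)" if "i \<in> I" for i
    by (rule is_matching_mono[OF assms(1)[OF that]]) (use that in auto)
  then show "(\<Union>i\<in>I. f i) \<subseteq> graph_edges (\<Union>i\<in>I. W i) E"
    unfolding is_matching_def by blast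
next
  fix d e assume "d \<in> (\<Union>i\<in>I. f i)" "e \<in> (\<Union>i\<in>I. f i)" "d \<noteq> e"
  then obtain i j where ij: "i \<in> I" "d \<in> f i" "j \<in> I" "e \<in> f j" by blast
  then have "d \<subseteq> W i" "e \<subseteq> W j"
    using Union_matching_subset[OF assms(1)] by blast+
  then show "d \<inter> e = {}"
    using ij \<open>d \<noteq> e\<close> assms(2)[of i j] is_matching_disjoint[OF assms(1)] by blast
qed

lemma matchings_disjoint:
  assumes "is_matching W E M" "is_matching W' E' N" "W \<inter> W' = {}"
  shows "M \<inter> N = {}"
proof -
  have "e \<noteq> {}" if "e \<in> M" for e using is_matchingE[OF assms(1) that] by blast
  then show ?thesis
    using Union_matching_subset[OF assms(1)] Union_matching_subset[OF assms(2)] assms(3) by blast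
qed

lemma is_matching_Un:
  assumes "is_matching W E M" "is_matching W' E N" "W \<inter> W' = {}"
  shows "is_matching (W \<union> W') E (M \<union> N)"
proof -
  have "is_matching (\<Union>b. if b then W else W') E (\<Union>b. if b then M else N)"
    by (rule is_matching_UN) (use assms in \<open>auto split: if_splits\<close>)
  then show ?thesis by (simp add: UNIV_bool Un_commute)
qed

lemma finite_matching:
  assumes "finite W" "is_matching W E M"
  shows "finite M"
  by (rule finite_UnionD, rule finite_subset[OF Union_matching_subset[OF assms(2)] assms(1)])

lemma card_matching_Un:
  assumes "finite W" "is_matching W E M" "finite W'" "is_matching W' E' N" "W \<inter> W' = {}"
  shows "card (M \<union> N) = card M + card N"
  using finite_matching[OF assms(1,2)] finite_matching[OF assms(3,4)]
    matchings_disjoint[OF assms(2,4,5)] by (rule card_Un_disjoint)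

lemma card_matching_UN:
  assumes "finite I" "\<And>i. i \<in> I \<Longrightarrow> finite (W i)" "\<And>i. i \<in> I \<Longrightarrow> is_matching (W i) E (f i)"
    and "\<And>i j. i \<in> I \<Longrightarrow> j \<in> I \<Longrightarrow> i \<noteq> j \<Longrightarrow> W i \<inter> W j = {}"
  shows "card (\<Union>i\<in>I. f i) = (\<Sum>i\<in>I. card (f i))"
proof (rule card_UN_disjoint)
  show "\<forall>i\<in>I. finite (f i)"
    using assms(2,3) finite_matching by blast
  show "\<forall>i\<in>I. \<forall>j\<in>I. i \<noteq> j \<longrightarrow> f i \<inter> f j = {}"
    using assms(3,4) matchings_disjoint by metis
qed fact

lemma finite_matchings:
  assumes "finite W"
  shows "finite {M. is_matching W E M}"
proof (rule finite_subset)
  show "{M. is_matching W E M} \<subseteq> Pow (Pow W)"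
    using Union_matching_subset by fast
qed (use assms in simp)

lemma card_le_matching_number: "finite W \<Longrightarrow> is_matching W E M \<Longrightarrow> card M \<le> matching_number W E"
  unfolding matching_number_def by (rule Max_ge) (simp_all add: finite_matchings)

lemma max_matching_exists:
  assumes "finite W"
  obtains M where "is_max_matching W E M"
proof -
  have "Max (card ` {M. is_matching W E M}) \<in> card ` {M. is_matching W E M}"
    using is_matching_empty by (intro Max_in) (use finite_matchings[OF assms] in auto)
  then show thesis
    using that unfolding is_max_matching_def matching_number_def by auto
qed

lemma path_matching:
  assumes "distinct ps" "successively E ps"
  shows "\<exists>P. is_matching (set ps) E P \<and> card P = length ps div 2"
  using assms
proof (induction ps rule: induct_list012)
  case (3 x y ps)
  then obtain P where P: "is_matching (set ps) E P" "card P = length ps div 2"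
    by (auto simp: successively_Cons)
  have edge: "is_matching {x, y} E {{x, y}}"
    using "3.prems"(2) by (intro is_matching_edge) auto
  have disjoint: "{x, y} \<inter> set ps = {}" using "3.prems"(1) by auto
  have "is_matching (set (x # y # ps)) E (insert {x, y} P)"
    using is_matching_Un[OF edge P(1) disjoint] by simp
  moreover have "card (insert {x, y} P) = length (x # y # ps) div 2"
    using card_matching_Un[OF _ edge _ P(1) disjoint] P(2) by simp
  ultimately show ?case by blast
qed (use is_matching_empty in fastforce)+

context simple_graph
begin

lemma card_Union_matching:
  assumes "is_matching W E M"
  shows "card (\<Union>M) = 2 * card M"
proof -
  have card_edge: "card e = 2" if "e \<in> M" for e
    using is_matchingE[OF assms that] irrefl by (metis card_2_iff)
  have "card (\<Union>M) = (\<Sum>e\<in>M. card e)"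
  proof (rule card_Union_disjoint)
    show "pairwise disjnt M"
      using assms by (auto simp: is_matching_def pairwise_def disjnt_def)
    show "finite e" if "e \<in> M" for e
      using card_edge[OF that] by (metis card.infinite zero_neq_numeral)
  qed
  then show ?thesis using card_edge by simp
qed

lemma matching_partner:
  assumes "is_matching W E M" "x \<in> \<Union>M"
  obtains y where "{x, y} \<in> M" "E x y"
proof -
  obtain e where e: "e \<in> M" "x \<in> e" using assms(2) by blast
  obtain a b where ab: "e = {a, b}" "E a b" using is_matchingE[OF assms(1) e(1)] by metis
  then consider (first) "x = a" | (second) "x = b" using e(2) by blast
  then show thesis
  proof cases
    case first
    then show ?thesis using that[of b] e(1) ab by simp
  next
    case second
    then show ?thesis using that[of a] e(1) ab sym by (simp add: insert_commute)
  qed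
qed

lemma matching_has_pendant_edge:
  assumes M: "is_matching W E M" "M \<noteq> {}" "finite W"
    and cycles: "\<And>ds. is_cycle E ds \<Longrightarrow> set ds = C"
    and v: "v \<in> C" "\<And>e. e \<in> M \<Longrightarrow> v \<in> e \<Longrightarrow> \<not> e \<subseteq> C"
  obtains l p where "{l, p} \<in> M" "E l p" "\<And>q. q \<in> \<Union>M \<Longrightarrow> E l q \<Longrightarrow> q = p"
proof -
  have partner: "\<exists>p\<in>\<Union>M. {w, p} \<in> M \<and> E w p" if "w \<in> \<Union>M" for w
    using matching_partner[OF M(1) that] by blast
  have finite: "finite (\<Union>M)"
    using finite_subset[OF Union_matching_subset[OF M(1)] M(3)] .
  have nonempty: "\<Union>M \<noteq> {}"
    using M(2) is_matchingE[OF M(1)] by blast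
  have off_cycle: "v \<notin> \<Union>M \<or> (\<exists>w\<in>\<Union>M - C. E v w)"
  proof (cases "v \<in> \<Union>M")
    case True
    then obtain p where p: "p \<in> \<Union>M" "{v, p} \<in> M" "E v p" using partner by blast
    then have "p \<notin> C" using v(2)[of "{v, p}"] v(1) by simp
    then show ?thesis using p by blast
  qed blast
  obtain l where l: "l \<in> \<Union>M" "\<exists>!p. p \<in> \<Union>M \<and> E l p"
    using exists_pendant_vertex[OF finite nonempty _ cycles v(1) off_cycle] partner by blast
  show thesis using partner[OF l(1)] l(2) that by metis
qed

end

lemma nonsingular_on_Union_matching:
  fixes A :: "real^'v^'v"
  assumes "simple_graph E" and pattern: "\<And>x y. A $ x $ y \<noteq> 0 \<longleftrightarrow> E x y"
    and cycles: "\<And>ds. is_cycle E ds \<Longrightarrow> set ds = C"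
    and v: "v \<in> C"
    and M: "is_matching UNIV E M" "\<And>e. e \<in> M \<Longrightarrow> v \<in> e \<Longrightarrow> \<not> e \<subseteq> C"
  shows "nonsingular_on A (\<Union>M)"
  using M
proof (induction "card M" arbitrary: M)
  case 0
  then have "M = {}" by simp
  then show ?case by (simp add: nonsingular_on_empty)
next
  case (Suc m)
  interpret simple_graph E by fact
  have "M \<noteq> {}" using Suc.hyps(2) by auto
  then obtain l p where p: "{l, p} \<in> M" "E l p" and leaf: "\<And>q. q \<in> \<Union>M \<Longrightarrow> E l q \<Longrightarrow> q = p"
    using matching_has_pendant_edge[OF Suc.prems(1) _ finite cycles v Suc.prems(2)] by metis
  define N where "N = M - {{l, p}}"
  have "N \<subseteq> M" and M_eq: "M = insert {l, p} N" using p(1) by (auto simp: N_def)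
  have "e \<inter> {l, p} = {}" if "e \<in> N" for e
    using that is_matching_disjoint[OF Suc.prems(1) _ p(1)] by (auto simp: N_def)
  then have new: "l \<notin> \<Union>N" "p \<notin> \<Union>N" by auto
  have "nonsingular_on A (\<Union>N)"
  proof (rule Suc.hyps(1))
    show "m = card N" using Suc.hyps(2) p(1) by (simp add: N_def)
  qed (use Suc.prems is_matching_subset \<open>N \<subseteq> M\<close> in blast)+
  moreover have "\<not> E l w" "\<not> E w l" if "w \<in> \<Union>N" for w
    using that leaf[of w] sym new(2) \<open>N \<subseteq> M\<close> by blast+
  ultimately have "nonsingular_on A (insert l (insert p (\<Union>N)))"
    using new p(2) sym irrefl by (intro nonsingular_on_insert_pendant) (metis pattern)+
  then show ?case by (simp add: M_eq)
qed

subsection \<open>Stars\<close>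

definition star_centre :: "'v set \<Rightarrow> ('v \<Rightarrow> 'v \<Rightarrow> bool) \<Rightarrow> 'v \<Rightarrow> bool" where
  "star_centre W E c \<longleftrightarrow> c \<in> W \<and> (\<forall>x\<in>W. x \<noteq> c \<longrightarrow> E c x) \<and>
     (\<forall>x\<in>W. \<forall>y\<in>W. E x y \<longrightarrow> x = c \<or> y = c)"

lemma is_star_iff_star_centre: "is_star W E \<longleftrightarrow> (\<exists>c. star_centre W E c)"
  by (auto simp: is_star_def star_centre_def)

context simple_graph
begin

lemma edges_meet_if_matching_number_le_1:
  assumes "finite W" "matching_number W E \<le> 1" "e \<in> graph_edges W E" "f \<in> graph_edges W E"
  shows "e \<inter> f \<noteq> {}"
proof
  assume disjoint: "e \<inter> f = {}"
  then have "is_matching W E {e, f}"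
    using assms(3,4) by (auto simp: is_matching_def)
  moreover have "e \<noteq> f" using disjoint assms(3) by (auto simp: graph_edges_def)
  ultimately show False
    using card_le_matching_number[OF assms(1), of E "{e, f}"] assms(2) by simp
qed

lemma common_vertex_if_edges_meet:
  assumes triangle_free: "\<And>a b c. E a b \<Longrightarrow> E b c \<Longrightarrow> \<not> E c a"
    and meet: "\<And>e f. e \<in> graph_edges W E \<Longrightarrow> f \<in> graph_edges W E \<Longrightarrow> e \<inter> f \<noteq> {}"
    and "W \<noteq> {}"
  obtains c where "c \<in> W" "\<And>e. e \<in> graph_edges W E \<Longrightarrow> c \<in> e"
proof (cases "\<exists>a\<in>W. \<forall>e\<in>graph_edges W E. a \<in> e")
  case False
  then obtain e where e: "e \<in> graph_edges W E" using \<open>W \<noteq> {}\<close> by blast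
  then obtain a b where ab: "e = {a, b}" "a \<in> W" "b \<in> W" "E a b" by (auto simp: graph_edges_def)
  obtain f where f: "f \<in> graph_edges W E" "a \<notin> f" using False ab(2) by blast
  then have "b \<in> f" using meet[OF e f(1)] ab(1) by blast
  then obtain d where d: "f = {b, d}" "E b d"
    using f(1) sym by (auto simp: graph_edges_def)
  have "b \<in> g" if g: "g \<in> graph_edges W E" for g
  proof (rule ccontr)
    assume "b \<notin> g"
    then have "a \<in> g" "d \<in> g" using meet[OF g e] meet[OF g f(1)] ab(1) d(1) by blast+
    moreover have "a \<noteq> d" using f(2) d(1) by blast
    ultimately have "E d a" using g sym by (auto simp: graph_edges_def)
    then show False using triangle_free ab(4) d(2) by blast
  qed
  then show thesis using that ab(3) by blast
qed (use that in blast)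

lemma is_star_if_matching_number_le_1:
  assumes "finite W" "W \<noteq> {}" "matching_number W E \<le> 1"
    and no_isolated: "\<And>x. x \<in> W \<Longrightarrow> \<exists>y\<in>W. E x y"
    and triangle_free: "\<And>a b c. E a b \<Longrightarrow> E b c \<Longrightarrow> \<not> E c a"
  shows "is_star W E"
proof -
  obtain c where c: "c \<in> W" "\<And>e. e \<in> graph_edges W E \<Longrightarrow> c \<in> e"
  proof (rule common_vertex_if_edges_meet)
    show "e \<inter> f \<noteq> {}" if "e \<in> graph_edges W E" "f \<in> graph_edges W E" for e f
      using edges_meet_if_matching_number_le_1[OF assms(1,3) that] .
  qed (use triangle_free assms(2) in blast)+
  have "x = c \<or> y = c" if "x \<in> W" "y \<in> W" "E x y" for x y
    using c(2)[of "{x, y}"] that by (auto simp: graph_edges_def)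
  moreover from this have "E c x" if "x \<in> W" "x \<noteq> c" for x
    using no_isolated[OF that(1)] that sym by blast
  ultimately show ?thesis using c(1) unfolding is_star_def by blast
qed

lemma unsaturated_star_vertex:
  assumes "finite W" "star_centre W E c" "v \<in> W" "W \<noteq> {v}" "\<not> saturated W E v"
  shows "c \<noteq> v" and "\<exists>l\<in>W. l \<noteq> v \<and> E c l"
proof -
  obtain M where M: "is_max_matching W E M" "v \<notin> \<Union>M"
    using assms(5) unfolding saturated_def by blast
  obtain x where "x \<in> W" "x \<noteq> c" using assms(3,4) by blast
  then have "is_matching W E {{c, x}}"
    using assms(2) by (intro is_matching_edge) (auto simp: star_centre_def)
  then have "card M \<noteq> 0"
    using card_le_matching_number[OF assms(1)] M(1) by (fastforce simp: is_max_matching_def)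
  then obtain e where e: "e \<in> M" by fastforce
  then obtain x y where xy: "e = {x, y}" "x \<in> W" "y \<in> W" "E x y"
    using is_matchingE M(1) unfolding is_max_matching_def by metis
  have "x \<noteq> v" "y \<noteq> v" using M(2) e xy(1) by auto
  moreover have "x = c \<or> y = c" using assms(2) xy(2-4) by (auto simp: star_centre_def)
  ultimately show "c \<noteq> v" "\<exists>l\<in>W. l \<noteq> v \<and> E c l" using xy sym by blast+
qed

end

subsection \<open>Oddly-oriented cycles\<close>

lemma skew_entry_eq_0_iff: "skew_entry ar x y = 0 \<longleftrightarrow> \<not> und ar x y"
  by (auto simp: skew_entry_def und_def)

lemma skew_entry_swap: "oriented_graph ar \<Longrightarrow> skew_entry ar y x = - skew_entry ar x y"
  by (auto simp: skew_entry_def oriented_graph_def)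

lemma skew_entry_square: "und ar x y \<Longrightarrow> skew_entry ar x y * skew_entry ar x y = 1"
  by (auto simp: skew_entry_def und_def)

lemma skew_adj_nonzero_iff: "skew_adj ar $ x $ y \<noteq> 0 \<longleftrightarrow> und ar x y"
  by (simp add: skew_adj_def skew_entry_eq_0_iff)

lemma simple_graph_und: "oriented_graph ar \<Longrightarrow> simple_graph (und ar)"
  by unfold_locales (auto simp: oriented_graph_def und_def)

definition chordless :: "('v \<Rightarrow> 'v \<Rightarrow> bool) \<Rightarrow> 'v list \<Rightarrow> bool" where
  "chordless E cs \<longleftrightarrow> (\<forall>x\<in>set cs. \<forall>y\<in>set cs. E x y \<longrightarrow> {x, y} \<in> cycle_edges cs)"

lemma chordless_cycle_neighbour:
  assumes "is_cycle E cs" "chordless E cs" "u \<in> set cs" "E (cyclic_nth cs (Suc i)) u"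
  shows "u = cyclic_nth cs i \<or> u = cyclic_nth cs (i + 2)"
proof -
  note cs = is_cycleD(2,3)[OF assms(1)]
  have "cyclic_nth cs (Suc i) \<in> set cs"
    using range_cyclic_nth[OF cs(2)] by blast
  then have "{cyclic_nth cs (Suc i), u} \<in> cycle_edges cs"
    using assms(2-4) unfolding chordless_def by blast
  then obtain j where "{cyclic_nth cs (Suc i), u} = {cyclic_nth cs j, cyclic_nth cs (Suc j)}"
    unfolding cycle_edges_cyclic_nth[OF cs(2)] by blast
  then consider "cyclic_nth cs (Suc i) = cyclic_nth cs j" "u = cyclic_nth cs (Suc j)"
    | "cyclic_nth cs (Suc i) = cyclic_nth cs (Suc j)" "u = cyclic_nth cs j"
    by (auto simp: doubleton_eq_iff)
  then show ?thesis
    by cases (use cyclic_nth_Suc_eq_iff[OF cs] in auto)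
qed

lemma chordless_cycle_row_sum:
  fixes x :: "'v \<Rightarrow> real"
  assumes orient: "oriented_graph ar" and cycle: "is_cycle (und ar) cs"
    and chordless: "chordless (und ar) cs"
  shows "(\<Sum>u\<in>set cs. skew_entry ar (cyclic_nth cs (Suc i)) u * x u) =
    skew_entry ar (cyclic_nth cs (Suc i)) (cyclic_nth cs (i + 2)) * x (cyclic_nth cs (i + 2)) -
    skew_entry ar (cyclic_nth cs i) (cyclic_nth cs (Suc i)) * x (cyclic_nth cs i)"
proof -
  note cs = is_cycleD[OF cycle]
  let ?c = "cyclic_nth cs"
  have "i mod length cs \<noteq> (i + 2) mod length cs"
  proof
    assume "i mod length cs = (i + 2) mod length cs"
    then have "length cs dvd (i + 2) - i" by (metis mod_eq_dvd_iff_nat le_add1)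
    then show False using cs(1) by (auto dest: dvd_imp_le)
  qed
  then have distinct: "?c i \<noteq> ?c (i + 2)"
    by (simp add: cyclic_nth_eq_iff[OF cs(2,3)])
  have "(\<Sum>u\<in>set cs. skew_entry ar (?c (Suc i)) u * x u) =
      (\<Sum>u\<in>{?c i, ?c (i + 2)}. skew_entry ar (?c (Suc i)) u * x u)"
  proof (rule sum.mono_neutral_right)
    show "{?c i, ?c (i + 2)} \<subseteq> set cs"
      using range_cyclic_nth[OF cs(3)] by blast
    show "\<forall>u\<in>set cs - {?c i, ?c (i + 2)}. skew_entry ar (?c (Suc i)) u * x u = 0"
      using chordless_cycle_neighbour[OF cycle chordless] by (auto simp: skew_entry_eq_0_iff)
  qed simp
  then show ?thesis
    using distinct skew_entry_swap[OF orient, of "?c i" "?c (Suc i)"] by simp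
qed

lemma chordless_cycle_kernel_step:
  fixes x :: "'v \<Rightarrow> real"
  assumes orient: "oriented_graph ar" and cycle: "is_cycle (und ar) cs"
    and chordless: "chordless (und ar) cs"
    and kernel: "(\<Sum>u\<in>set cs. skew_entry ar (cyclic_nth cs (Suc i)) u * x u) = 0"
  shows "x (cyclic_nth cs (i + 2)) =
    skew_entry ar (cyclic_nth cs i) (cyclic_nth cs (Suc i)) *
    skew_entry ar (cyclic_nth cs (Suc i)) (cyclic_nth cs (i + 2)) * x (cyclic_nth cs i)"
proof -
  let ?s = "skew_entry ar (cyclic_nth cs i) (cyclic_nth cs (Suc i))"
  let ?t = "skew_entry ar (cyclic_nth cs (Suc i)) (cyclic_nth cs (i + 2))"
  have "?t * x (cyclic_nth cs (i + 2)) = ?s * x (cyclic_nth cs i)"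
    using kernel chordless_cycle_row_sum[OF orient cycle chordless] by simp
  then have "(?t * ?t) * x (cyclic_nth cs (i + 2)) = ?s * ?t * x (cyclic_nth cs i)"
    by (metis mult.assoc mult.commute)
  moreover have "?t * ?t = 1"
    using is_cycle_cyclic_nth[OF cycle, of "Suc i"] by (simp add: skew_entry_square)
  ultimately show ?thesis by (metis mult_1)
qed

lemma prod_periodic_shift:
  fixes s :: "nat \<Rightarrow> 'a::comm_monoid_mult"
  assumes periodic: "\<And>i. s (i + k) = s i"
  shows "(\<Prod>j<k. s (i + j)) = (\<Prod>j<k. s j)"
proof (induction i)
  case (Suc i)
  show ?case
  proof (cases k)
    case (Suc m)
    have "(\<Prod>j<k. s (Suc i + j)) = (\<Prod>j<m. s (i + Suc j)) * s (i + k)"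
      by (simp add: Suc)
    also have "\<dots> = (\<Prod>j<k. s (i + j))"
      unfolding periodic unfolding Suc prod.lessThan_Suc_shift by (simp add: mult.commute)
    finally show ?thesis using Suc.IH by simp
  qed simp
qed simp

lemma two_step_recurrence:
  fixes s y :: "nat \<Rightarrow> 'a::comm_monoid_mult"
  assumes "\<And>i. y (i + 2) = s i * s (Suc i) * y i"
  shows "y (i + 2 * m) = (\<Prod>j<2 * m. s (i + j)) * y i"
proof (induction m)
  case (Suc m)
  have "y (i + 2 * Suc m) = s (i + 2 * m) * s (Suc (i + 2 * m)) * y (i + 2 * m)"
    using assms[of "i + 2 * m"] by simp
  also have "\<dots> = (\<Prod>j<2 * Suc m. s (i + j)) * y i"
    unfolding Suc.IH by (simp add: mult_ac)
  finally show ?case .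
qed simp

lemma cycle_sign_prod_cyclic_nth:
  "cycle_sign_prod ar cs = (\<Prod>i<length cs. skew_entry ar (cyclic_nth cs i) (cyclic_nth cs (Suc i)))"
  unfolding cycle_sign_prod_def by (rule prod.cong) (auto simp: cyclic_nth_def)

lemma cycle_sign_prod_oddly_oriented:
  assumes cycle: "is_cycle (und ar) cs" and "even (length cs)" "\<not> evenly_oriented ar cs"
  shows "cycle_sign_prod ar cs = -1"
proof -
  have "cycle_sign_prod ar cs * cycle_sign_prod ar cs = 1"
    by (simp add: cycle_sign_prod_cyclic_nth skew_entry_square[OF is_cycle_cyclic_nth[OF cycle]]
        flip: prod.distrib)
  moreover have "cycle_sign_prod ar cs \<le> 0"
    using assms(2,3) by (simp add: evenly_oriented_def)
  ultimately show ?thesis by (metis square_eq_1_iff not_one_le_zero)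
qed

text \<open>A kernel vector changes sign when it is transported once around the cycle in steps of length two.\<close>

lemma nonsingular_on_oddly_oriented_cycle:
  assumes orient: "oriented_graph ar" and cycle: "is_cycle (und ar) cs"
    and chordless: "chordless (und ar) cs"
    and even: "even (length cs)" and odd_orientation: "\<not> evenly_oriented ar cs"
  shows "nonsingular_on (skew_adj ar) (set cs)"
  unfolding nonsingular_on_def
proof (intro allI impI)
  fix x assume "\<forall>i\<in>set cs. (\<Sum>j\<in>set cs. skew_adj ar $ i $ j * x j) = 0"
  then have kernel: "(\<Sum>u\<in>set cs. skew_entry ar w u * x u) = 0" if "w \<in> set cs" for w
    using that by (simp add: skew_adj_def)
  note nonempty = is_cycleD(3)[OF cycle]
  define k where "k = length cs"
  define s where "s i = skew_entry ar (cyclic_nth cs i) (cyclic_nth cs (Suc i))" for i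
  define y where "y i = x (cyclic_nth cs i)" for i
  have "y (i + 2) = s i * s (Suc i) * y i" for i
    using chordless_cycle_kernel_step[OF orient cycle chordless kernel] range_cyclic_nth[OF nonempty]
    unfolding s_def y_def by auto
  note transport = two_step_recurrence[of y s, OF this]
  have periodic: "cyclic_nth cs (i + k) = cyclic_nth cs i" for i
    by (simp add: cyclic_nth_def k_def)
  have sign: "(\<Prod>j<k. s j) = -1"
    using cycle_sign_prod_oddly_oriented[OF cycle even odd_orientation]
    by (simp add: cycle_sign_prod_cyclic_nth s_def k_def)
  have "y i = 0" for i
  proof -
    have "y (i + k) = (\<Prod>j<k. s (i + j)) * y i"
      using transport[of i "k div 2"] even by (simp add: k_def)
    also have "(\<Prod>j<k. s (i + j)) = -1"
      using prod_periodic_shift[of s k i] periodic sign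
      by (metis add_Suc s_def)
    finally show ?thesis by (simp add: y_def periodic)
  qed
  then show "\<forall>w\<in>set cs. x w = 0"
    unfolding range_cyclic_nth[OF nonempty, symmetric] by (auto simp: y_def)
qed

subsection \<open>Recognising \<open>U*\<close>\<close>

lemma iso_ustar_if_enumeration:
  fixes xs :: "'v::finite list"
  assumes "distinct xs" "set xs = UNIV"
    and adj: "\<And>i j. i < length xs \<Longrightarrow> j < length xs \<Longrightarrow>
      E (xs ! i) (xs ! j) \<longleftrightarrow> ustar_adj k (length xs) i j"
  shows "iso_ustar E k CARD('v)"
proof -
  have card: "length xs = CARD('v)"
    using distinct_card[OF assms(1)] assms(2) by simp
  have nth: "bij_betw ((!) xs) {0..<length xs} UNIV"
    using assms(1,2) by (intro bij_betw_nth) (auto simp: atLeast0LessThan)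
  define f where "f = inv_into {0..<length xs} ((!) xs)"
  have "bij_betw f UNIV {0..<length xs}"
    unfolding f_def by (rule bij_betw_inv_into[OF nth])
  moreover have "E x y \<longleftrightarrow> ustar_adj k (length xs) (f x) (f y)" for x y
  proof -
    have "xs ! f z = z" for z
      unfolding f_def by (rule bij_betw_inv_into_right[OF nth]) simp
    moreover have "f z < length xs" for z
      using bij_betwE[OF \<open>bij_betw f UNIV {0..<length xs}\<close>] by auto
    ultimately show ?thesis using adj[of "f x" "f y"] by simp
  qed
  ultimately show ?thesis
    unfolding iso_ustar_def card[symmetric] by blast
qed

lemma nth_doubleton_eq_iff:
  assumes "distinct xs" "i < length xs" "j < length xs" "l < length xs" "m < length xs"
  shows "{xs ! i, xs ! j} = {xs ! l, xs ! m} \<longleftrightarrow> {i, j} = {l, m}"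
  using assms by (simp add: doubleton_eq_iff nth_eq_iff_index_eq)

lemma nth_doubleton_in_cycle_edges_iff:
  assumes xs: "xs = cs @ rs" "distinct xs" and "cs \<noteq> []" and ij: "i < length xs" "j < length xs"
  shows "{xs ! i, xs ! j} \<in> cycle_edges cs \<longleftrightarrow>
    i < length cs \<and> j < length cs \<and> (j = (i + 1) mod length cs \<or> i = (j + 1) mod length cs)"
proof -
  let ?k = "length cs"
  have bound: "(l + 1) mod ?k < ?k" for l using \<open>cs \<noteq> []\<close> by simp
  have "cs ! l = xs ! l" if "l < ?k" for l using that by (simp add: xs(1) nth_append)
  then have "cycle_edges cs = {{xs ! l, xs ! ((l + 1) mod ?k)} |l. l < ?k}"
    using bound by (simp add: cycle_edges_def cong: rev_conj_cong)
  then have "{xs ! i, xs ! j} \<in> cycle_edges cs \<longleftrightarrow>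
      (\<exists>l<?k. {xs ! i, xs ! j} = {xs ! l, xs ! ((l + 1) mod ?k)})" by blast
  also have "\<dots> \<longleftrightarrow> (\<exists>l<?k. {i, j} = {l, (l + 1) mod ?k})"
  proof (intro ex_cong1 conj_cong refl)
    fix l assume "l < ?k"
    moreover have "?k \<le> length xs" by (simp add: xs(1))
    ultimately have "l < length xs" "(l + 1) mod ?k < length xs" using bound[of l] by linarith+
    then show "{xs ! i, xs ! j} = {xs ! l, xs ! ((l + 1) mod ?k)} \<longleftrightarrow> {i, j} = {l, (l + 1) mod ?k}"
      by (rule nth_doubleton_eq_iff[OF xs(2) ij])
  qed
  also have "\<dots> \<longleftrightarrow> i < ?k \<and> j < ?k \<and> (j = (i + 1) mod ?k \<or> i = (j + 1) mod ?k)"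
    unfolding doubleton_eq_iff using bound by blast
  finally show ?thesis .
qed

lemma iso_ustar_if_edges:
  fixes E :: "'v::finite \<Rightarrow> 'v \<Rightarrow> bool"
  assumes "distinct cs" "cs \<noteq> []" "c \<notin> set cs"
    and edges: "\<And>x y. E x y \<longleftrightarrow> {x, y} \<in> cycle_edges cs \<or> {x, y} = {hd cs, c} \<or>
      (\<exists>z. z \<notin> insert c (set cs) \<and> {x, y} = {c, z})"
  shows "iso_ustar E (length cs) CARD('v)"
proof -
  obtain rs where rs: "set rs = - insert c (set cs)" "distinct rs"
    using finite_distinct_list[OF finite] by metis
  define xs where "xs = cs @ c # rs"
  let ?k = "length cs" and ?n = "length xs"
  have xs: "distinct xs" "set xs = UNIV" and "?k < ?n"
    using assms(1,3) rs by (auto simp: xs_def)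
  have c_nth: "c = xs ! ?k" and hd_nth: "hd cs = xs ! 0"
    using assms(2) by (simp_all add: xs_def nth_append hd_conv_nth)
  have c_iff: "xs ! l = c \<longleftrightarrow> l = ?k" if "l < ?n" for l
    unfolding c_nth using nth_eq_iff_index_eq[OF xs(1) that \<open>?k < ?n\<close>] .
  have leaf_iff: "xs ! l \<notin> insert c (set cs) \<longleftrightarrow> ?k < l" if "l < ?n" for l
  proof -
    have "insert c (set cs) = (!) xs ` {0..<Suc ?k}"
      using nth_image[of "Suc ?k" xs] \<open>?k < ?n\<close> by (simp add: xs_def)
    then have "xs ! l \<in> insert c (set cs) \<longleftrightarrow> (\<exists>m<Suc ?k. xs ! l = xs ! m)"
      by auto
    also have "\<dots> \<longleftrightarrow> (\<exists>m<Suc ?k. l = m)"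
      using nth_eq_iff_index_eq[OF xs(1) that] \<open>?k < ?n\<close> by (metis Suc_leI less_le_trans)
    finally show ?thesis by auto
  qed
  show ?thesis
  proof (rule iso_ustar_if_enumeration[OF xs])
    fix i j assume ij: "i < ?n" "j < ?n"
    have "{xs ! i, xs ! j} = {hd cs, c} \<longleftrightarrow> {i, j} = {0, ?k}"
      unfolding hd_nth c_nth using \<open>?k < ?n\<close> by (intro nth_doubleton_eq_iff[OF xs(1) ij]) auto
    moreover have "(\<exists>z. z \<notin> insert c (set cs) \<and> {xs ! i, xs ! j} = {c, z}) \<longleftrightarrow>
        (i = ?k \<and> ?k < j) \<or> (j = ?k \<and> ?k < i)"
      unfolding doubleton_eq_iff using c_iff leaf_iff ij by blast
    ultimately show "E (xs ! i) (xs ! j) \<longleftrightarrow> ustar_adj ?k ?n i j"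
      unfolding edges nth_doubleton_in_cycle_edges_iff[OF xs_def xs(1) assms(2) ij] ustar_adj_def
      using ij by simp
  qed
qed

subsection \<open>Branches of a unicyclic graph\<close>

lemma successively_rtranclp: "successively R xs \<Longrightarrow> x \<in> set xs \<Longrightarrow> R\<^sup>*\<^sup>* (hd xs) x"
proof (induction xs)
  case (Cons y xs)
  show ?case
  proof (cases "x = y")
    case False
    then have "R y (hd xs)" "R\<^sup>*\<^sup>* (hd xs) x"
      using Cons by (auto simp: successively_Cons)
    then show ?thesis by (simp add: converse_rtranclp_into_rtranclp)
  qed simp
qed simp

lemma (in simple_graph) rtranclp_sym: "E\<^sup>*\<^sup>* x y \<Longrightarrow> E\<^sup>*\<^sup>* y x"
  using sympD[OF symp_rtranclp, of E] sym by (blast intro: sympI)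

locale unicyclic_graph = simple_graph E for E :: "'v::finite \<Rightarrow> 'v \<Rightarrow> bool" +
  fixes cs :: "'v list"
  assumes unicyclic: "unicyclic E" and cycle: "is_cycle E cs"
begin

abbreviation off_cycle where "off_cycle \<equiv> del_cycle E cs"
abbreviation branch where "branch \<equiv> branch_verts E cs"

lemma cycle_edges_unique: "is_cycle E ds \<Longrightarrow> cycle_edges ds = cycle_edges cs"
  using unicyclic cycle unfolding unicyclic_def by blast

lemma cycle_set_unique: "is_cycle E ds \<Longrightarrow> set ds = set cs"
  using cycle_edges_unique Union_cycle_edges is_cycleD(3) cycle by metis

lemma cycle_edge_subset: "e \<in> cycle_edges cs \<Longrightarrow> e \<subseteq> set cs"
  using Union_cycle_edges[OF is_cycleD(3)[OF cycle]] by blast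

lemma cycle_edge_adj: "{x, y} \<in> cycle_edges cs \<Longrightarrow> E x y"
  using cycle_edge_imp_edge[OF cycle] sym by (metis doubleton_eq_iff)

lemma cycle_starting_at:
  assumes "v \<in> set cs"
  obtains ds where "is_cycle E (v # ds)" "set ds = set cs - {v}" "length ds = length cs - 1"
proof -
  obtain as bs where cs: "cs = as @ v # bs" using assms by (meson split_list)
  then have "is_cycle E (v # bs @ as)"
    using is_cycle_append_commute[of E as "v # bs"] cycle by simp
  moreover have "set (bs @ as) = set cs - {v}"
    using is_cycleD(2)[OF cycle] cs by auto
  ultimately show thesis using that[of "bs @ as"] cs by simp
qed

lemma off_cycle_le: "off_cycle \<le> E"
  by (auto simp: del_cycle_def)

sublocale off_cycle: simple_graph off_cycle
  by unfold_locales (auto simp: del_cycle_def insert_commute sym irrefl)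

lemma off_cycle_if_not_subset: "E x y \<Longrightarrow> \<not> {x, y} \<subseteq> set cs \<Longrightarrow> off_cycle x y"
  using cycle_edge_subset by (auto simp: del_cycle_def)

lemma not_is_cycle_off_cycle: "\<not> is_cycle off_cycle ds"
proof
  assume ds: "is_cycle off_cycle ds"
  then have "{cyclic_nth ds 0, cyclic_nth ds (Suc 0)} \<in> cycle_edges cs"
    using cycle_edges_unique[OF is_cycle_mono[OF ds off_cycle_le]]
      cycle_edges_cyclic_nth[OF is_cycleD(3)[OF ds]] by blast
  then show False
    using is_cycle_cyclic_nth[OF ds, of 0] by (simp add: del_cycle_def)
qed

lemma off_cycle_triangle_free:
  assumes "off_cycle a b" "off_cycle b c"
  shows "\<not> off_cycle c a"
proof
  assume "off_cycle c a"
  moreover have "a \<noteq> b" "b \<noteq> c" "c \<noteq> a"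
    using assms \<open>off_cycle c a\<close> off_cycle.irrefl by blast+
  ultimately have "is_cycle off_cycle [a, b, c]"
    using assms by (simp add: is_cycle_iff_closed_path is_path_def)
  then show False using not_is_cycle_off_cycle by blast
qed

lemma cycle_edges_subset_if_connected:
  assumes "F \<le> E" "E x y" "\<not> F x y" "F\<^sup>*\<^sup>* x y"
  shows "cycle_edges cs \<subseteq> insert {x, y} {{a, b} |a b. F a b}"
proof -
  define G where "G a b \<longleftrightarrow> F a b \<or> {a, b} = {x, y}" for a b
  have "G \<le> E"
    using assms(1,2) sym by (auto simp: G_def doubleton_eq_iff)
  obtain ps where ps: "is_path F ps" "hd ps = x" "last ps = y"
    using rtranclp_imp_is_path[OF assms(4)] by blast
  have "x \<noteq> y" using assms(2) irrefl by blast
  have "3 \<le> length ps"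
  proof (rule ccontr)
    assume "\<not> 3 \<le> length ps"
    then consider a where "ps = [a]" | a b where "ps = [a, b]"
      using ps(1) by (cases ps; cases "tl ps"; cases "tl (tl ps)") (auto simp: is_path_def)
    then show False using ps \<open>x \<noteq> y\<close> assms(3) by cases (auto simp: is_path_def)
  qed
  moreover have "is_path G ps"
    by (rule is_path_mono[OF ps(1)]) (auto simp: G_def)
  ultimately have G_cycle: "is_cycle G ps"
    unfolding is_cycle_iff_closed_path using ps(2,3) by (auto simp: G_def)
  have "e \<in> insert {x, y} {{a, b} |a b. F a b}" if e: "e \<in> cycle_edges ps" for e
  proof -
    obtain a b where "e = {a, b}" "G a b" using cycle_edge_imp_edge[OF G_cycle e] .
    then show ?thesis unfolding G_def by blast
  qed
  then show ?thesis
    using cycle_edges_unique[OF is_cycle_mono[OF G_cycle \<open>G \<le> E\<close>]] by blast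
qed

text \<open>A walk from \<open>u\<close> to another cycle vertex that avoids the cycle edges can be continued along the
  cycle to a neighbour of \<open>u\<close>; closing it up gives a cycle that misses the other cycle edge at \<open>u\<close>.\<close>

lemma off_cycle_not_connected:
  assumes u: "u \<in> set cs" and v: "v \<in> set cs" and walk: "off_cycle\<^sup>*\<^sup>* u v"
  shows "u = v"
proof (rule ccontr)
  assume "u \<noteq> v"
  obtain ds where ds: "is_cycle E (u # ds)" "set ds = set cs - {u}"
    using cycle_starting_at[OF u] by metis
  have "ds \<noteq> []" and distinct: "distinct ds" "u \<notin> set ds" and "2 \<le> length ds"
    using is_cycleD[OF ds(1)] by auto
  define F where "F x y \<longleftrightarrow> off_cycle x y \<or> (E x y \<and> x \<noteq> u \<and> y \<noteq> u)" for x y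
  interpret F: simple_graph F
    by unfold_locales (auto simp: F_def off_cycle.sym off_cycle.irrefl sym irrefl)
  have first: "{u, hd ds} \<in> cycle_edges cs" and closing: "{last ds, u} \<in> cycle_edges cs"
    using first_edge_in_cycle_edges[OF \<open>ds \<noteq> []\<close>] closing_edge_in_cycle_edges[OF \<open>ds \<noteq> []\<close>]
      cycle_edges_unique[OF ds(1)] by auto
  have "successively E ds"
    using ds(1) \<open>ds \<noteq> []\<close> by (simp add: is_cycle_iff_closed_path is_path_def successively_Cons)
  then have "successively F ds"
    by (rule successively_mono) (use distinct(2) in \<open>auto simp: F_def\<close>)
  then have "F\<^sup>*\<^sup>* v (hd ds)"
    using successively_rtranclp F.rtranclp_sym v ds(2) \<open>u \<noteq> v\<close> by (metis DiffI singletonD)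
  moreover have "off_cycle \<le> F" by (auto simp: F_def)
  then have "F\<^sup>*\<^sup>* u v" using predicate2D[OF rtranclp_mono] walk by metis
  ultimately have "F\<^sup>*\<^sup>* u (hd ds)" by simp
  moreover have "F \<le> E" "\<not> F u (hd ds)"
    using off_cycle_le first by (auto simp: F_def del_cycle_def)
  ultimately have "cycle_edges cs \<subseteq> insert {u, hd ds} {{a, b} |a b. F a b}"
    using cycle_edges_subset_if_connected cycle_edge_adj[OF first] by blast
  moreover have "last ds \<noteq> hd ds"
    using distinct(1) \<open>2 \<le> length ds\<close> by (cases ds) auto
  then have "{last ds, u} \<noteq> {u, hd ds}" by (auto simp: doubleton_eq_iff)
  ultimately obtain a b where "{last ds, u} = {a, b}" "F a b" using closing by blast
  then show False
    using closing by (auto simp: F_def del_cycle_def doubleton_eq_iff insert_commute)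
qed

lemma branch_root: "v \<in> branch v"
  by (simp add: branch_verts_def)

lemma branch_step: "x \<in> branch v \<Longrightarrow> off_cycle x y \<Longrightarrow> y \<in> branch v"
  unfolding branch_verts_def by (auto intro: rtranclp.rtrancl_into_rtrancl)

lemma branch_unique:
  assumes "u \<in> set cs" "v \<in> set cs" "w \<in> branch u" "w \<in> branch v"
  shows "u = v"
proof (rule off_cycle_not_connected[OF assms(1,2)])
  have "off_cycle\<^sup>*\<^sup>* u w" "off_cycle\<^sup>*\<^sup>* w v"
    using assms(3,4) off_cycle.rtranclp_sym by (auto simp: branch_verts_def)
  then show "off_cycle\<^sup>*\<^sup>* u v" by simp
qed

lemma branches_disjoint: "u \<in> set cs \<Longrightarrow> v \<in> set cs \<Longrightarrow> u \<noteq> v \<Longrightarrow> branch u \<inter> branch v = {}"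
  using branch_unique by blast

lemma branch_cycle_vertex: "v \<in> set cs \<Longrightarrow> w \<in> branch v \<Longrightarrow> w \<in> set cs \<Longrightarrow> w = v"
  using branch_unique branch_root by blast

lemma branch_cover:
  obtains v where "v \<in> set cs" "w \<in> branch v"
proof -
  have "E\<^sup>*\<^sup>* (hd cs) w"
    using unicyclic by (simp add: unicyclic_def connected_graph_def)
  then have "\<exists>v\<in>set cs. w \<in> branch v"
  proof (induction rule: rtranclp_induct)
    case base
    show ?case using branch_root is_cycleD(3)[OF cycle] by (metis hd_in_set)
  next
    case (step w z)
    show ?case
    proof (cases "off_cycle w z")
      case True
      then show ?thesis using step.IH branch_step by blast
    next
      case False
      then have "z \<in> set cs"
        using step.hyps(2) cycle_edge_subset by (auto simp: del_cycle_def)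
      then show ?thesis using branch_root by blast
    qed
  qed
  then show thesis using that by blast
qed

lemma chordless: "chordless E cs"
  unfolding chordless_def
proof (intro ballI impI)
  fix x y assume xy: "x \<in> set cs" "y \<in> set cs" "E x y"
  show "{x, y} \<in> cycle_edges cs"
  proof (rule ccontr)
    assume "{x, y} \<notin> cycle_edges cs"
    then have "off_cycle x y" using xy(3) by (simp add: del_cycle_def)
    then have "x = y" using off_cycle_not_connected[OF xy(1,2)] by blast
    then show False using xy(3) irrefl by blast
  qed
qed

lemma branch_no_isolated:
  assumes "x \<in> branch v" "branch v \<noteq> {v}"
  shows "\<exists>y\<in>branch v. off_cycle x y"
proof (cases "x = v")
  case True
  obtain w where "w \<in> branch v" "w \<noteq> v" using assms(2) branch_root by blast
  then have "off_cycle\<^sup>*\<^sup>* v w" by (simp add: branch_verts_def)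
  then obtain y where "off_cycle v y"
    using \<open>w \<noteq> v\<close> by (metis converse_rtranclpE)
  then show ?thesis using True branch_step branch_root by blast
next
  case False
  have "off_cycle\<^sup>*\<^sup>* v x" using assms(1) by (simp add: branch_verts_def)
  then obtain y where "off_cycle\<^sup>*\<^sup>* v y" "off_cycle y x"
    using False by (metis rtranclp.cases)
  then show ?thesis using off_cycle.sym by (auto simp: branch_verts_def)
qed

lemma branch_trivial_if_matching_number_0:
  assumes "matching_number (branch v) off_cycle = 0"
  shows "branch v = {v}"
proof (rule ccontr)
  assume "branch v \<noteq> {v}"
  then obtain y where "y \<in> branch v" "off_cycle v y"
    using branch_no_isolated[OF branch_root] by blast
  then have "is_matching (branch v) off_cycle {{v, y}}"
    by (intro is_matching_edge branch_root)
  then show False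
    using card_le_matching_number[OF finite] assms by fastforce
qed

lemma is_star_branch:
  assumes "matching_number (branch v) off_cycle \<le> 1"
  shows "is_star (branch v) off_cycle"
proof (cases "branch v = {v}")
  case True
  then show ?thesis using off_cycle.irrefl by (auto simp: is_star_def)
next
  case False
  show ?thesis
  proof (rule off_cycle.is_star_if_matching_number_le_1[OF finite _ assms])
    show "branch v \<noteq> {}" using branch_root by blast
  qed (use branch_no_isolated[OF _ False] off_cycle_triangle_free in blast)+
qed

lemma matching_of_cycle_minus_vertex:
  assumes "v \<in> set cs"
  obtains P where "is_matching (set cs - {v}) E P" "card P = (length cs - 1) div 2"
proof -
  obtain ds where ds: "is_cycle E (v # ds)" "set ds = set cs - {v}" "length ds = length cs - 1"
    using cycle_starting_at[OF assms] .
  have "distinct ds" "successively E ds"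
    using ds(1) by (auto simp: is_cycle_iff_closed_path is_path_def successively_Cons)
  then obtain P where "is_matching (set ds) E P" "card P = length ds div 2"
    using path_matching by blast
  then show thesis using that[of P] ds(2,3) by simp
qed

lemma single_branch_eq:
  assumes v: "v \<in> set cs" and trivial: "\<forall>u\<in>set cs - {v}. branch u = {u}"
  shows "branch v = insert v (- set cs)"
proof (intro equalityI subsetI)
  fix w assume w: "w \<in> insert v (- set cs)"
  obtain u where "u \<in> set cs" "w \<in> branch u" using branch_cover .
  then show "w \<in> branch v" using w trivial branch_root by (cases "u = v") auto
qed (use branch_cycle_vertex[OF v] in blast)

lemma single_star_branch_edge_iff:
  assumes star: "star_centre (branch v) off_cycle c"
    and trivial: "\<forall>u\<in>set cs - {v}. branch u = {u}"
  shows "off_cycle x y \<longleftrightarrow> (\<exists>z\<in>branch v - {c}. {x, y} = {c, z})"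
proof
  assume xy: "off_cycle x y"
  then have "x \<noteq> y" using off_cycle.irrefl by blast
  obtain u where u: "u \<in> set cs" "x \<in> branch u" "y \<in> branch u"
    using branch_cover branch_step[OF _ xy] by metis
  then have "u = v"
    using trivial \<open>x \<noteq> y\<close> by (metis DiffI singletonD)
  then show "\<exists>z\<in>branch v - {c}. {x, y} = {c, z}"
    using star xy u(2,3) \<open>x \<noteq> y\<close> unfolding star_centre_def
    by (metis Diff_iff insert_commute singletonD)
next
  assume "\<exists>z\<in>branch v - {c}. {x, y} = {c, z}"
  then show "off_cycle x y"
    using star off_cycle.sym by (auto simp: star_centre_def doubleton_eq_iff)
qed

lemma iso_ustar_if_single_star_branch:
  assumes v: "v \<in> set cs" and star: "star_centre (branch v) off_cycle c" "c \<noteq> v"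
    and trivial: "\<forall>u\<in>set cs - {v}. branch u = {u}"
  shows "iso_ustar E (length cs) CARD('v)"
proof -
  obtain ds where ds: "is_cycle E (v # ds)" "set ds = set cs - {v}" "length ds = length cs - 1"
    using cycle_starting_at[OF v] .
  have set: "set (v # ds) = set cs" and length: "length (v # ds) = length cs"
    using v ds(2,3) is_cycleD(1)[OF cycle] by auto
  have "c \<notin> set cs"
    using star branch_cycle_vertex[OF v] by (auto simp: star_centre_def)
  have "iso_ustar E (length (v # ds)) CARD('v)"
  proof (rule iso_ustar_if_edges)
    fix x y
    have "E x y \<longleftrightarrow> {x, y} \<in> cycle_edges cs \<or> off_cycle x y"
      using cycle_edge_adj by (auto simp: del_cycle_def)
    also have "off_cycle x y \<longleftrightarrow> (\<exists>z\<in>insert v (- insert c (set cs)). {x, y} = {c, z})"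
      using single_star_branch_edge_iff[OF star(1) trivial] single_branch_eq[OF v trivial] star(2)
      by auto
    finally show "E x y \<longleftrightarrow> {x, y} \<in> cycle_edges (v # ds) \<or> {x, y} = {hd (v # ds), c} \<or>
        (\<exists>z. z \<notin> insert c (set (v # ds)) \<and> {x, y} = {c, z})"
      unfolding cycle_edges_unique[OF ds(1)] set by (auto simp: insert_commute)
  qed (use \<open>c \<notin> set cs\<close> set is_cycleD(2)[OF ds(1)] in auto)
  then show ?thesis unfolding length .
qed

end

subsection \<open>Unicyclic graphs of small skew-rank\<close>

locale oriented_unicyclic_graph =
  fixes ar :: "'v::finite \<Rightarrow> 'v \<Rightarrow> bool" and cs :: "'v list"
  assumes oriented: "oriented_graph ar"
    and unicyclic_und: "unicyclic (und ar)" and cycle_und: "is_cycle (und ar) cs"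
begin

sublocale unicyclic_graph "und ar" cs
  using simple_graph_und[OF oriented] unicyclic_und cycle_und
  by (simp add: unicyclic_graph_def unicyclic_graph_axioms_def)

lemma two_card_matching_le_skew_rank:
  assumes "v \<in> set cs" "is_matching UNIV (und ar) M"
    and "\<And>e. e \<in> M \<Longrightarrow> v \<in> e \<Longrightarrow> \<not> e \<subseteq> set cs"
  shows "2 * card M \<le> skew_rank ar"
proof -
  have "nonsingular_on (skew_adj ar) (\<Union>M)"
    by (rule nonsingular_on_Union_matching[OF _ skew_adj_nonzero_iff cycle_set_unique assms])
      unfold_locales
  then show ?thesis
    using card_le_rank_if_nonsingular_on card_Union_matching[OF assms(2)]
    unfolding skew_rank_def by metis
qed

lemma evenly_oriented_if_edge_off_cycle:
  assumes "even (length cs)" "skew_rank ar \<le> length cs"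
    and edge: "und ar l p" "l \<notin> set cs" "p \<notin> set cs"
    and pendant: "\<And>u. u \<in> set cs \<Longrightarrow> \<not> und ar l u"
  shows "evenly_oriented ar cs"
proof (rule ccontr)
  assume "\<not> evenly_oriented ar cs"
  then have "nonsingular_on (skew_adj ar) (set cs)"
    using nonsingular_on_oddly_oriented_cycle[OF oriented cycle chordless assms(1)] by blast
  then have "nonsingular_on (skew_adj ar) (insert l (insert p (set cs)))"
    using edge pendant sym irrefl
    by (intro nonsingular_on_insert_pendant) (metis skew_adj_nonzero_iff)+
  then have "card (insert l (insert p (set cs))) \<le> skew_rank ar"
    unfolding skew_rank_def by (rule card_le_rank_if_nonsingular_on)
  moreover have "l \<noteq> p" using edge(1) irrefl by blast
  ultimately show False
    using edge(2,3) assms(2) distinct_card[OF is_cycleD(2)[OF cycle]] by simp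
qed

context
  assumes small_rank: "skew_rank ar \<le> 2 * ((length cs - 1) div 2) + 2"
begin

lemma saturated_branch_matching_numbers:
  assumes v: "v \<in> set cs" and saturated: "saturated (branch v) off_cycle v"
  shows "matching_number (branch v) off_cycle = 1"
    and "matching_number (UNIV - branch v) (und ar) = (length cs - 1) div 2"
proof -
  obtain B where B: "is_max_matching (branch v) off_cycle B" "v \<in> \<Union>B"
    using max_matching_exists[OF finite] saturated unfolding saturated_def by metis
  obtain R where R: "is_max_matching (UNIV - branch v) (und ar) R"
    using max_matching_exists[OF finite] .
  have B_matching: "is_matching (branch v) off_cycle B"
    and R_matching: "is_matching (UNIV - branch v) (und ar) R"
    using B(1) R by (simp_all add: is_max_matching_def)
  have union: "is_matching UNIV (und ar) (B \<union> R)"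
    using is_matching_Un[OF is_matching_mono[OF B_matching order_refl off_cycle_le] R_matching] by simp
  have "2 * card (B \<union> R) \<le> skew_rank ar"
  proof (rule two_card_matching_le_skew_rank[OF v union])
    fix e assume e: "e \<in> B \<union> R" "v \<in> e"
    then have "e \<in> B" using Union_matching_subset[OF R_matching] branch_root by blast
    then obtain x y where xy: "e = {x, y}" "x \<in> branch v" "y \<in> branch v" "off_cycle x y"
      using is_matchingE[OF B_matching] by metis
    then have "x \<noteq> y" using off_cycle.irrefl by blast
    then show "\<not> e \<subseteq> set cs" using xy branch_cycle_vertex[OF v] by blast
  qed
  then have "card B + card R \<le> (length cs - 1) div 2 + 1"
    using small_rank card_matching_Un[OF finite B_matching finite R_matching] by simp
  moreover have "(length cs - 1) div 2 \<le> card R"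
  proof -
    obtain P where P: "is_matching (set cs - {v}) (und ar) P" "card P = (length cs - 1) div 2"
      using matching_of_cycle_minus_vertex[OF v] .
    have "is_matching (UNIV - branch v) (und ar) P"
      by (rule is_matching_mono[OF P(1)]) (use branch_cycle_vertex[OF v] in auto)
    then show ?thesis
      using card_le_matching_number[OF finite] P(2) R by (metis is_max_matching_def)
  qed
  moreover have "card B \<noteq> 0" using B(2) by auto
  ultimately show "matching_number (branch v) off_cycle = 1"
    and "matching_number (UNIV - branch v) (und ar) = (length cs - 1) div 2"
    using B(1) R unfolding is_max_matching_def by linarith+
qed

context
  assumes unsaturated: "\<And>v. v \<in> set cs \<Longrightarrow> \<not> saturated (branch v) off_cycle v"
begin

lemma union_of_branch_matchings:
  obtains N where "is_matching (- set cs) (und ar) N"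
    "card N = (\<Sum>u\<in>set cs. matching_number (branch u) off_cycle)"
proof -
  obtain f where f: "\<And>u. u \<in> set cs \<Longrightarrow> is_max_matching (branch u) off_cycle (f u) \<and> u \<notin> \<Union>(f u)"
    using unsaturated unfolding saturated_def by metis
  then have f_matching: "is_matching (branch u) off_cycle (f u)" if "u \<in> set cs" for u
    using that by (simp add: is_max_matching_def)
  have "w \<notin> set cs" if "u \<in> set cs" "w \<in> \<Union>(f u)" for u w
    using that f[OF that(1)] Union_matching_subset[OF f_matching[OF that(1)]]
      branch_cycle_vertex[OF that(1), of w] by auto
  then have "\<Union>(\<Union>u\<in>set cs. f u) \<subseteq> - set cs" by blast
  with is_matching_UN[OF f_matching branches_disjoint]
  have "is_matching (- set cs) off_cycle (\<Union>u\<in>set cs. f u)"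
    by (rule is_matching_restrict)
  then have "is_matching (- set cs) (und ar) (\<Union>u\<in>set cs. f u)"
    by (rule is_matching_mono[OF _ order_refl off_cycle_le])
  moreover have "card (\<Union>u\<in>set cs. f u) = (\<Sum>u\<in>set cs. card (f u))"
    by (rule card_matching_UN[OF _ finite f_matching branches_disjoint]) simp
  moreover have "\<dots> = (\<Sum>u\<in>set cs. matching_number (branch u) off_cycle)"
    by (rule sum.cong) (use f in \<open>auto simp: is_max_matching_def\<close>)
  ultimately show thesis using that by simp
qed

lemma sum_branch_matching_numbers_le_1:
  "(\<Sum>u\<in>set cs. matching_number (branch u) off_cycle) \<le> 1"
proof -
  obtain N where N: "is_matching (- set cs) (und ar) N"
    "card N = (\<Sum>u\<in>set cs. matching_number (branch u) off_cycle)"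
    using union_of_branch_matchings .
  have v: "hd cs \<in> set cs" using is_cycleD(3)[OF cycle] by simp
  obtain P where P: "is_matching (set cs - {hd cs}) (und ar) P" "card P = (length cs - 1) div 2"
    using matching_of_cycle_minus_vertex[OF v] .
  have disjoint: "- set cs \<inter> (set cs - {hd cs}) = {}" by blast
  have "2 * card (N \<union> P) \<le> skew_rank ar"
  proof (rule two_card_matching_le_skew_rank[OF v])
    show "is_matching UNIV (und ar) (N \<union> P)"
      by (rule is_matching_mono[OF is_matching_Un[OF N(1) P(1) disjoint]]) auto
    show "\<not> e \<subseteq> set cs" if "e \<in> N \<union> P" "hd cs \<in> e" for e
      using that v Union_matching_subset[OF N(1)] Union_matching_subset[OF P(1)] by blast
  qed
  then show ?thesis
    using small_rank N(2) P(2) card_matching_Un[OF finite N(1) finite P(1) disjoint] by simp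
qed

lemma unsaturated_single_star_branch:
  assumes "set cs \<noteq> UNIV"
  obtains v c where "v \<in> set cs" "branch v \<noteq> {v}" "star_centre (branch v) off_cycle c"
    "\<forall>u\<in>set cs - {v}. branch u = {u}"
proof -
  let ?\<beta> = "\<lambda>u. matching_number (branch u) off_cycle"
  obtain w where "w \<notin> set cs" using assms by blast
  moreover obtain v where v: "v \<in> set cs" "w \<in> branch v" using branch_cover .
  ultimately have nontrivial: "branch v \<noteq> {v}" by auto
  then have "?\<beta> v \<noteq> 0" using branch_trivial_if_matching_number_0 by blast
  moreover have "?\<beta> v + (\<Sum>u\<in>set cs - {v}. ?\<beta> u) \<le> 1"
    using sum_branch_matching_numbers_le_1 sum.remove[OF _ v(1), of ?\<beta>] by simp
  ultimately have "?\<beta> v = 1" and "(\<Sum>u\<in>set cs - {v}. ?\<beta> u) = 0" by linarith+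
  then have "\<forall>u\<in>set cs - {v}. branch u = {u}"
    using branch_trivial_if_matching_number_0 by simp
  moreover obtain c where "star_centre (branch v) off_cycle c"
    using is_star_branch[of v] \<open>?\<beta> v = 1\<close> by (auto simp: is_star_iff_star_centre)
  ultimately show thesis using that v(1) nontrivial by blast
qed

lemma unsaturated_imp_ustar:
  assumes "set cs \<noteq> UNIV"
  shows "iso_ustar (und ar) (length cs) CARD('v)"
    and "even (length cs) \<Longrightarrow> evenly_oriented ar cs"
proof -
  obtain v c where v: "v \<in> set cs" and nontrivial: "branch v \<noteq> {v}"
    and star: "star_centre (branch v) off_cycle c"
    and trivial: "\<forall>u\<in>set cs - {v}. branch u = {u}"
    using unsaturated_single_star_branch[OF assms] .
  have "c \<noteq> v" and "\<exists>l\<in>branch v. l \<noteq> v \<and> off_cycle c l"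
    using off_cycle.unsaturated_star_vertex[OF finite star branch_root nontrivial unsaturated[OF v]] .
  show "iso_ustar (und ar) (length cs) CARD('v)"
    using v star \<open>c \<noteq> v\<close> trivial by (rule iso_ustar_if_single_star_branch)
  obtain l where l: "l \<in> branch v" "l \<noteq> v" "off_cycle c l"
    using \<open>\<exists>l\<in>branch v. l \<noteq> v \<and> off_cycle c l\<close> by blast
  have "c \<notin> set cs" "l \<notin> set cs"
    using star \<open>c \<noteq> v\<close> l branch_cycle_vertex[OF v] by (auto simp: star_centre_def)
  moreover have "und ar l c"
    using l(3) off_cycle_le sym by blast
  moreover have "\<not> und ar l u" if u: "u \<in> set cs" for u
  proof
    assume "und ar l u"
    then have lu: "off_cycle l u" using \<open>l \<notin> set cs\<close> off_cycle_if_not_subset by blast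
    then have "u \<in> branch v" using l(1) branch_step by blast
    then have "l = c" using star l(1) lu u \<open>c \<notin> set cs\<close> by (auto simp: star_centre_def)
    then show False using l(3) off_cycle.irrefl by blast
  qed
  moreover have "skew_rank ar \<le> length cs" if "even (length cs)"
    using small_rank that is_cycleD(1)[OF cycle] by (auto elim!: evenE)
  ultimately show "even (length cs) \<Longrightarrow> evenly_oriented ar cs"
    using evenly_oriented_if_edge_off_cycle by blast
qed

end

end

end

theorem theorem4p6:
  fixes ar :: "'v::finite \<Rightarrow> 'v \<Rightarrow> bool"
    and cs :: "'v list" and k n :: nat
  assumes orient: "oriented_graph ar"
    and unicyc: "unicyclic (und ar)"
    and cyc: "is_cycle (und ar) cs"
    and k_def: "k = length cs"
    and n_def: "n = CARD('v)"
    and not_cycle: "k < n"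
    and sr: "skew_rank ar = (if even k then k else k + 1)"
  shows
    "(\<forall>v \<in> set cs. saturated (branch_verts (und ar) cs v) (del_cycle (und ar) cs) v \<longrightarrow>
        is_star (branch_verts (und ar) cs v) (del_cycle (und ar) cs) \<and>
        2 * matching_number (UNIV - branch_verts (und ar) cs v) (und ar)
          = (if even k then k - 2 else k - 1))
     \<and>
     ((\<forall>v \<in> set cs. \<not> saturated (branch_verts (und ar) cs v) (del_cycle (und ar) cs) v) \<longrightarrow>
        (odd k \<longrightarrow> iso_ustar (und ar) k n) \<and>
        (even k \<longrightarrow> iso_ustar (und ar) k n \<and> evenly_oriented ar cs))"
proof -
  interpret oriented_unicyclic_graph ar cs
    by unfold_locales fact+
  have "3 \<le> k" using is_cycleD(1)[OF cyc] by (simp add: k_def)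
  then have parity: "2 * ((k - 1) div 2) = (if even k then k - 2 else k - 1)"
    by (auto elim!: evenE oddE)
  then have rank: "skew_rank ar \<le> 2 * ((length cs - 1) div 2) + 2"
    using sr \<open>3 \<le> k\<close> by (auto simp: k_def)
  have proper: "set cs \<noteq> UNIV"
    using not_cycle k_def n_def distinct_card[OF is_cycleD(2)[OF cyc]] by auto
  have "is_star (branch v) off_cycle \<and>
      2 * matching_number (UNIV - branch v) (und ar) = (if even k then k - 2 else k - 1)"
    if "v \<in> set cs" "saturated (branch v) off_cycle v" for v
    using saturated_branch_matching_numbers[OF rank that] is_star_branch parity by (simp add: k_def)
  moreover have "iso_ustar (und ar) k n" and "even k \<Longrightarrow> evenly_oriented ar cs"
    if "\<forall>v\<in>set cs. \<not> saturated (branch v) off_cycle v"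
    using unsaturated_imp_ustar[OF rank _ proper] that by (auto simp: k_def n_def)
  ultimately show ?thesis by blast
qed

end
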